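(* Let $(F,m,\eta)$ be a weak monad on a category $\mathbb{B}$, and let $\vartheta:=m\cdot\eta F:F\to F$. Then any $\vartheta$-compatible $F$-module $(B,\varrho)$ is $\mathbb{K}_\vartheta$-firm, where $\mathbb{K}_\vartheta$ is the class of all $\vartheta$-compatible morphisms of $F$-modules.
   Context: A weak monad $(F,m,\eta)$ consists of an endofunctor $F$, an associative natural transformation $m:FF\to F$ and a natural transformation $\eta:I_{\mathbb{B}}\to F$ such that $\eta=m\cdot F\eta\cdot\eta$, $m=m\cdot mF\cdot F\eta F$ and $m\cdot F\eta=m\cdot\eta F$. (Non-unital) $F$-modules are pairs $(B,\varrho)$, $\varrho:F(B)\to B$, with $\varrho\cdot F(\varrho)=\varrho\cdot m_B$; morphisms commute with the structure maps; $F(B)$ is a module via $m_B$. A module $(B,\varrho)$ is ($\vartheta$-)compatible if $\varrho\cdot\vartheta_B=\varrho$. A module morphism $h:(B,\varrho)\to(B',\varrho')$ is $\vartheta$-compatible if $h\cdot\varrho\cdot\eta_B=h=\varrho'\cdot\eta_{B'}\cdot h$ (either equality implies the other). For a class $\mathbb{K}$ of morphisms closed under composition, a fork $B\rightrightarrows C\xrightarrow{s}D$ (with $s\cdot f=s\cdot g$ for the parallel pair $f,g$) is a $\mathbb{K}$-coequaliser if $s\in\mathbb{K}$ and for any $h:C\to Q$ in $\mathbb{K}$ with $h\cdot f=h\cdot g$ there is a unique $q:D\to Q$ in $\mathbb{K}$ with $h=q\cdot s$. An $F$-module $(B,\varrho)$ is $\mathbb{K}$-firm if the fork $FF(B)\rightrightarrows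 F(B)\xrightarrow{\varrho}B$ with parallel pair $m_B$, $F(\varrho)$ is a $\mathbb{K}$-coequaliser in the category of non-unital $F$-modules. *)

theory Defs
  imports Main
begin

section \<open>Categories, functors, natural transformations\<close>

record ('o, 'm) category =
  Ob :: "'o set"
  Ar :: "'m set"
  Dom :: "'m \<Rightarrow> 'o"
  Cod :: "'m \<Rightarrow> 'o"
  Ident :: "'o \<Rightarrow> 'm"
  Comp :: "'m \<Rightarrow> 'm \<Rightarrow> 'm"  (infixr \<open>\<cdot>\<index>\<close> 70)

definition hom :: "('o, 'm) category \<Rightarrow> 'o \<Rightarrow> 'o \<Rightarrow> 'm set" where
  "hom C A B = {f \<in> Ar C. Dom C f = A \<and> Cod C f = B}"

locale category =
  fixes C :: "('o, 'm) category" (structure)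
  assumes Dom_Ob: "f \<in> Ar C \<Longrightarrow> Dom C f \<in> Ob C"
    and Cod_Ob: "f \<in> Ar C \<Longrightarrow> Cod C f \<in> Ob C"
    and Ident_hom: "A \<in> Ob C \<Longrightarrow> Ident C A \<in> hom C A A"
    and Comp_hom: "f \<in> hom C A B \<Longrightarrow> g \<in> hom C B D \<Longrightarrow> g \<cdot> f \<in> hom C A D"
    and Comp_Ident: "f \<in> hom C A B \<Longrightarrow> f \<cdot> Ident C A = f"
    and Ident_Comp: "f \<in> hom C A B \<Longrightarrow> Ident C B \<cdot> f = f"
    and Comp_assoc: "f \<in> hom C A B \<Longrightarrow> g \<in> hom C B D \<Longrightarrow> h \<in> hom C D E
      \<Longrightarrow> (h \<cdot> g) \<cdot> f = h \<cdot> (g \<cdot> f)"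

record ('o, 'm) endofunctor_data =
  ob :: "'o \<Rightarrow> 'o"
  ar :: "'m \<Rightarrow> 'm"

locale endofunctor = category C
  for C :: "('o, 'm) category" (structure) +
  fixes F :: "('o, 'm) endofunctor_data"
  assumes ob_Ob: "A \<in> Ob C \<Longrightarrow> ob F A \<in> Ob C"
    and ar_hom: "f \<in> hom C A B \<Longrightarrow> ar F f \<in> hom C (ob F A) (ob F B)"
    and ar_Ident: "A \<in> Ob C \<Longrightarrow> ar F (Ident C A) = Ident C (ob F A)"
    and ar_Comp: "f \<in> hom C A B \<Longrightarrow> g \<in> hom C B D \<Longrightarrow> ar F (g \<cdot> f) = ar F g \<cdot> ar F f"

definition id_functor :: "('o, 'm) endofunctor_data" where
  "id_functor = \<lparr>ob = (\<lambda>A. A), ar = (\<lambda>f. f)\<rparr>"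

definition comp_functor ::
  "('o, 'm) endofunctor_data \<Rightarrow> ('o, 'm) endofunctor_data \<Rightarrow> ('o, 'm) endofunctor_data" where
  "comp_functor G F = \<lparr>ob = (\<lambda>A. ob G (ob F A)), ar = (\<lambda>f. ar G (ar F f))\<rparr>"

locale natural_transformation =
  F: endofunctor C F + G: endofunctor C G
  for C :: "('o, 'm) category" (structure) and F G +
  fixes \<tau> :: "'o \<Rightarrow> 'm"
  assumes component: "A \<in> Ob C \<Longrightarrow> \<tau> A \<in> hom C (ob F A) (ob G A)"
    and naturality: "f \<in> hom C A B \<Longrightarrow> \<tau> B \<cdot> ar F f = ar G f \<cdot> \<tau> A"

section \<open>Weak monads\<close>

text \<open>Equations between natural transformations are stated componentwise. At an object
  \<open>A\<close>, the whiskering \<open>F\<tau>\<close> has component \<open>F(\<tau>\<^sub>A)\<close> and \<open>\<tau>F\<close> has component \<open>\<tau>\<^bsub>F(A)\<^esub>\<close>.\<close>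

locale weak_monad = endofunctor C F
  for C :: "('o, 'm) category" (structure) and F +
  fixes m :: "'o \<Rightarrow> 'm" and \<eta> :: "'o \<Rightarrow> 'm"
  assumes m_natural: "natural_transformation C (comp_functor F F) F m"
    and \<eta>_natural: "natural_transformation C id_functor F \<eta>"
    and m_assoc: "A \<in> Ob C \<Longrightarrow> m A \<cdot> ar F (m A) = m A \<cdot> m (ob F A)"
    and \<eta>_regular: "A \<in> Ob C \<Longrightarrow> \<eta> A = m A \<cdot> ar F (\<eta> A) \<cdot> \<eta> A"
    and m_regular: "A \<in> Ob C \<Longrightarrow> m A = m A \<cdot> m (ob F A) \<cdot> ar F (\<eta> (ob F A))"
    and m_\<eta>_comm: "A \<in> Ob C \<Longrightarrow> m A \<cdot> ar F (\<eta> A) = m A \<cdot> \<eta> (ob F A)"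

definition theta ::
  "('o, 'm) category \<Rightarrow> ('o, 'm) endofunctor_data \<Rightarrow> ('o \<Rightarrow> 'm) \<Rightarrow> ('o \<Rightarrow> 'm) \<Rightarrow> 'o \<Rightarrow> 'm" where
  "theta C F m \<eta> = (\<lambda>A. m A \<cdot>\<^bsub>C\<^esub> \<eta> (ob F A))"

section \<open>The category of non-unital modules\<close>

definition modules ::
  "('o, 'm) category \<Rightarrow> ('o, 'm) endofunctor_data \<Rightarrow> ('o \<Rightarrow> 'm) \<Rightarrow> ('o \<times> 'm) set" where
  "modules C F m = {(B, \<rho>). B \<in> Ob C \<and> \<rho> \<in> hom C (ob F B) B
     \<and> \<rho> \<cdot>\<^bsub>C\<^esub> ar F \<rho> = \<rho> \<cdot>\<^bsub>C\<^esub> m B}"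

text \<open>A morphism of modules is a triple consisting of its source module, the underlying
  morphism and its target module, so that an underlying morphism can carry several
  module morphisms.\<close>

type_synonym ('o, 'm) module_morphism = "('o \<times> 'm) \<times> 'm \<times> ('o \<times> 'm)"

definition module_morphisms ::
  "('o, 'm) category \<Rightarrow> ('o, 'm) endofunctor_data \<Rightarrow> ('o \<Rightarrow> 'm) \<Rightarrow> ('o, 'm) module_morphism set"
  where
  "module_morphisms C F m = {((B, \<rho>), h, (B', \<rho>')).
     (B, \<rho>) \<in> modules C F m \<and> (B', \<rho>') \<in> modules C F m \<and> h \<in> hom C B B'
     \<and> h \<cdot>\<^bsub>C\<^esub> \<rho> = \<rho>' \<cdot>\<^bsub>C\<^esub> ar F h}"

definition module_category ::
  "('o, 'm) category \<Rightarrow> ('o, 'm) endofunctor_data \<Rightarrow> ('o \<Rightarrow> 'm)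
    \<Rightarrow> ('o \<times> 'm, ('o, 'm) module_morphism) category" where
  "module_category C F m = \<lparr>
     Ob = modules C F m,
     Ar = module_morphisms C F m,
     Dom = (\<lambda>(M, h, N). M),
     Cod = (\<lambda>(M, h, N). N),
     Ident = (\<lambda>M. (M, Ident C (fst M), M)),
     Comp = (\<lambda>(_, k, P) (M, h, _). (M, k \<cdot>\<^bsub>C\<^esub> h, P))\<rparr>"

definition compatible_module ::
  "('o, 'm) category \<Rightarrow> ('o, 'm) endofunctor_data \<Rightarrow> ('o \<Rightarrow> 'm) \<Rightarrow> ('o \<Rightarrow> 'm)
    \<Rightarrow> 'o \<times> 'm \<Rightarrow> bool" where
  "compatible_module C F m \<eta> = (\<lambda>(B, \<rho>).
     (B, \<rho>) \<in> modules C F m \<and> \<rho> \<cdot>\<^bsub>C\<^esub> theta C F m \<eta> B = \<rho>)"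

definition compatible_morphisms ::
  "('o, 'm) category \<Rightarrow> ('o, 'm) endofunctor_data \<Rightarrow> ('o \<Rightarrow> 'm) \<Rightarrow> ('o \<Rightarrow> 'm)
    \<Rightarrow> ('o, 'm) module_morphism set" where
  "compatible_morphisms C F m \<eta> = {((B, \<rho>), h, (B', \<rho>')).
     ((B, \<rho>), h, (B', \<rho>')) \<in> module_morphisms C F m
     \<and> h \<cdot>\<^bsub>C\<^esub> \<rho> \<cdot>\<^bsub>C\<^esub> \<eta> B = h \<and> \<rho>' \<cdot>\<^bsub>C\<^esub> \<eta> B' \<cdot>\<^bsub>C\<^esub> h = h}"

section \<open>Coequalisers relative to a class of morphisms, and firm modules\<close>

definition comp_closed :: "('o, 'm) category \<Rightarrow> 'm set \<Rightarrow> bool" where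
  "comp_closed C K \<longleftrightarrow> K \<subseteq> Ar C
     \<and> (\<forall>f\<in>K. \<forall>g\<in>K. Dom C g = Cod C f \<longrightarrow> g \<cdot>\<^bsub>C\<^esub> f \<in> K)"

definition fork :: "('o, 'm) category \<Rightarrow> 'm \<Rightarrow> 'm \<Rightarrow> 'm \<Rightarrow> bool" where
  "fork C f g s \<longleftrightarrow> f \<in> Ar C \<and> g \<in> hom C (Dom C f) (Cod C f)
     \<and> s \<in> Ar C \<and> Dom C s = Cod C f \<and> s \<cdot>\<^bsub>C\<^esub> f = s \<cdot>\<^bsub>C\<^esub> g"

text \<open>Only \<open>s\<close> and the test morphisms are required to lie in \<open>K\<close>; the parallel pair is not.
  The standing requirement that \<open>K\<close> be closed under composition is part of the definition.\<close>

definition K_coequaliser :: "('o, 'm) category \<Rightarrow> 'm set \<Rightarrow> 'm \<Rightarrow> 'm \<Rightarrow> 'm \<Rightarrow> bool" where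
  "K_coequaliser C K f g s \<longleftrightarrow> comp_closed C K \<and> fork C f g s \<and> s \<in> K
     \<and> (\<forall>h\<in>K. Dom C h = Cod C f \<and> h \<cdot>\<^bsub>C\<^esub> f = h \<cdot>\<^bsub>C\<^esub> g
          \<longrightarrow> (\<exists>!q. q \<in> K \<and> q \<in> hom C (Cod C s) (Cod C h) \<and> h = q \<cdot>\<^bsub>C\<^esub> s))"

definition K_firm ::
  "('o, 'm) category \<Rightarrow> ('o, 'm) endofunctor_data \<Rightarrow> ('o \<Rightarrow> 'm)
    \<Rightarrow> ('o, 'm) module_morphism set \<Rightarrow> 'o \<times> 'm \<Rightarrow> bool" where
  "K_firm C F m K = (\<lambda>(B, \<rho>).
     let FB = (ob F B, m B); FFB = (ob F (ob F B), m (ob F B))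
     in K_coequaliser (module_category C F m) K
          (FFB, m B, FB) (FFB, ar F \<rho>, FB) (FB, \<rho>, (B, \<rho>)))"

section \<open>Well-formedness of these notions\<close>

lemma hom_simps: "f \<in> hom C A B \<longleftrightarrow> f \<in> Ar C \<and> Dom C f = A \<and> Cod C f = B"
  by (simp add: hom_def)

context weak_monad
begin

lemma m_hom: "A \<in> Ob C \<Longrightarrow> m A \<in> hom C (ob F (ob F A)) (ob F A)"
  using natural_transformation.component[OF m_natural] by (simp add: comp_functor_def)

lemma m_nat: "f \<in> hom C A B \<Longrightarrow> m B \<cdot> ar F (ar F f) = ar F f \<cdot> m A"
  using natural_transformation.naturality[OF m_natural] by (simp add: comp_functor_def)

lemma \<eta>_hom: "A \<in> Ob C \<Longrightarrow> \<eta> A \<in> hom C A (ob F A)"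
  using natural_transformation.component[OF \<eta>_natural] by (simp add: id_functor_def)

lemma \<eta>_nat: "f \<in> hom C A B \<Longrightarrow> \<eta> B \<cdot> f = ar F f \<cdot> \<eta> A"
  using natural_transformation.naturality[OF \<eta>_natural] by (simp add: id_functor_def)

lemma free_module: "A \<in> Ob C \<Longrightarrow> (ob F A, m A) \<in> modules C F m"
  by (simp add: modules_def ob_Ob m_hom m_assoc)

lemma module_morphism_comp:
  assumes "(M, h, N) \<in> module_morphisms C F m" "(N, k, P) \<in> module_morphisms C F m"
  shows "(M, k \<cdot> h, P) \<in> module_morphisms C F m"
proof -
  obtain A a B b D d where MNP: "M = (A, a)" "N = (B, b)" "P = (D, d)"
    by (metis surj_pair)
  have h: "h \<in> hom C A B" "h \<cdot> a = b \<cdot> ar F h" and k: "k \<in> hom C B D" "k \<cdot> b = d \<cdot> ar F k"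
    and a: "a \<in> hom C (ob F A) A" and b: "b \<in> hom C (ob F B) B" and d: "d \<in> hom C (ob F D) D"
    using assms MNP by (auto simp: module_morphisms_def modules_def)
  have "(k \<cdot> h) \<cdot> a = k \<cdot> (b \<cdot> ar F h)"
    using Comp_assoc[OF a h(1) k(1)] h(2) by simp
  also have "\<dots> = (d \<cdot> ar F k) \<cdot> ar F h"
    using Comp_assoc[OF ar_hom[OF h(1)] b k(1)] k(2) by simp
  also have "\<dots> = d \<cdot> ar F (k \<cdot> h)"
    using Comp_assoc[OF ar_hom[OF h(1)] ar_hom[OF k(1)] d] ar_Comp[OF h(1) k(1)] by simp
  finally have "(k \<cdot> h) \<cdot> a = d \<cdot> ar F (k \<cdot> h)" .
  with assms MNP show ?thesis
    using Comp_hom[OF h(1) k(1)] by (auto simp: module_morphisms_def)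
qed

lemma module_identity:
  assumes "(A, a) \<in> modules C F m"
  shows "((A, a), Ident C A, (A, a)) \<in> module_morphisms C F m"
proof -
  have A: "A \<in> Ob C" and a: "a \<in> hom C (ob F A) A"
    using assms by (auto simp: modules_def)
  show ?thesis
    using assms Ident_hom[OF A] ar_Ident[OF A] Comp_Ident[OF a] Ident_Comp[OF a]
    by (simp add: module_morphisms_def)
qed

lemma module_hom:
  "f \<in> hom (module_category C F m) M N \<longleftrightarrow> (\<exists>h. f = (M, h, N)) \<and> f \<in> module_morphisms C F m"
  by (cases f) (auto simp: hom_def module_category_def)

lemma module_Comp: "(N', k, P) \<cdot>\<^bsub>module_category C F m\<^esub> (M, h, N) = (M, k \<cdot> h, P)"
  by (simp add: module_category_def)

lemma module_category_category: "category (module_category C F m)"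
proof (unfold_locales, goal_cases)
  case (1 f)
  then show ?case by (auto simp: module_category_def module_morphisms_def)
next
  case (2 f)
  then show ?case by (auto simp: module_category_def module_morphisms_def)
next
  case (3 M)
  then show ?case
    by (cases M) (auto simp: module_category_def hom_simps module_identity)
next
  case (4 f M N g P)
  then show ?case
    by (auto simp: module_hom module_Comp intro: module_morphism_comp)
next
  case (5 f M N)
  then obtain h where f: "f = (M, h, N)" "f \<in> module_morphisms C F m"
    by (auto simp: module_hom)
  then have "h \<in> hom C (fst M) (fst N)"
    by (auto simp: module_morphisms_def)
  then show ?case
    using f by (simp add: module_category_def Comp_Ident)
next
  case (6 f M N)
  then obtain h where f: "f = (M, h, N)" "f \<in> module_morphisms C F m"
    by (auto simp: module_hom)
  then have "h \<in> hom C (fst M) (fst N)"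
    by (auto simp: module_morphisms_def)
  then show ?case
    using f by (simp add: module_category_def Ident_Comp)
next
  case (7 f M N g P h Q)
  then obtain u v w where
    uvw: "f = (M, u, N)" "g = (N, v, P)" "h = (P, w, Q)"
    and mor: "f \<in> module_morphisms C F m" "g \<in> module_morphisms C F m"
      "h \<in> module_morphisms C F m"
    by (auto simp: module_hom)
  have "u \<in> hom C (fst M) (fst N)" "v \<in> hom C (fst N) (fst P)" "w \<in> hom C (fst P) (fst Q)"
    using uvw mor by (auto simp: module_morphisms_def)
  then show ?case
    using uvw by (simp add: module_Comp Comp_assoc)
qed

lemma compatible_morphisms_comp_closed:
  "comp_closed (module_category C F m) (compatible_morphisms C F m \<eta>)"
proof -
  have "(M, k \<cdot> h, P) \<in> compatible_morphisms C F m \<eta>"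
    if hK: "(M, h, N) \<in> compatible_morphisms C F m \<eta>"
      and kK: "(N, k, P) \<in> compatible_morphisms C F m \<eta>" for M h N k P
  proof -
    obtain A a B b D d where MNP: "M = (A, a)" "N = (B, b)" "P = (D, d)"
      by (metis surj_pair)
    have mor: "(M, k \<cdot> h, P) \<in> module_morphisms C F m"
      using hK kK module_morphism_comp by (auto simp: compatible_morphisms_def)
    have h: "h \<in> hom C A B" "h \<cdot> a \<cdot> \<eta> A = h" and k: "k \<in> hom C B D" "d \<cdot> \<eta> D \<cdot> k = k"
      and A: "A \<in> Ob C" and D: "D \<in> Ob C"
      and a: "a \<in> hom C (ob F A) A" and d: "d \<in> hom C (ob F D) D"
      using hK kK MNP by (auto simp: compatible_morphisms_def module_morphisms_def modules_def)
    have "(k \<cdot> h) \<cdot> a \<cdot> \<eta> A = k \<cdot> h"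
      using Comp_assoc[OF Comp_hom[OF \<eta>_hom[OF A] a] h(1) k(1)] h(2) by simp
    moreover have "d \<cdot> \<eta> D \<cdot> k \<cdot> h = (d \<cdot> \<eta> D \<cdot> k) \<cdot> h"
      using Comp_assoc[OF h(1) k(1) \<eta>_hom[OF D]]
        Comp_assoc[OF h(1) Comp_hom[OF k(1) \<eta>_hom[OF D]] d] by simp
    ultimately show ?thesis
      using mor MNP k(2) by (simp add: compatible_morphisms_def)
  qed
  then show ?thesis
    by (auto simp: comp_closed_def module_category_def compatible_morphisms_def)
qed

end

end

(* A compatible module satisfies \<rho> \<cdot> \<eta>_B \<cdot> \<rho> = \<rho> by naturality of \<eta>, so \<rho> is itself a compatible
   morphism. If h : F(B) \<rightarrow> Q is compatible with h \<cdot> m_B = h \<cdot> F(\<rho>), then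
   h = h \<cdot> m_B \<cdot> \<eta>_F(B) = h \<cdot> F(\<rho>) \<cdot> \<eta>_F(B) = h \<cdot> \<eta>_B \<cdot> \<rho>, so h factors through \<rho> by h \<cdot> \<eta>_B,
   and any compatible q with q \<cdot> \<rho> = h equals q \<cdot> \<rho> \<cdot> \<eta>_B = h \<cdot> \<eta>_B. *)
theory Submission
  imports Defs
begin

context weak_monad
begin

lemma multiplication_module_morphism:
  assumes "A \<in> Ob C"
  shows "((ob F (ob F A), m (ob F A)), m A, (ob F A, m A)) \<in> module_morphisms C F m"
  using assms by (simp add: module_morphisms_def free_module ob_Ob m_hom m_assoc)

text \<open>The morphism condition between the free modules is naturality of \<open>m\<close> at
  \<open>f\<close>. Applied to an action \<rho>, this places the second arrow of the parallel pair
  among the module morphisms.\<close>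

lemma functor_module_morphism:
  assumes "f \<in> hom C A A'"
  shows "((ob F A, m A), ar F f, (ob F A', m A')) \<in> module_morphisms C F m"
proof -
  have "A \<in> Ob C" "A' \<in> Ob C"
    using assms Dom_Ob Cod_Ob by (auto simp: hom_simps)
  then show ?thesis
    using assms by (simp add: module_morphisms_def free_module ar_hom m_nat)
qed

text \<open>With \<open>m B\<close> as the action on the source, the morphism condition for \<rho>
  is the module law itself.\<close>

lemma action_module_morphism:
  assumes "(B, \<rho>) \<in> modules C F m"
  shows "((ob F B, m B), \<rho>, (B, \<rho>)) \<in> module_morphisms C F m"
  using assms free_module by (auto simp: module_morphisms_def modules_def)

lemma action_compatible_morphism:
  assumes "compatible_module C F m \<eta> (B, \<rho>)"
  shows "((ob F B, m B), \<rho>, (B, \<rho>)) \<in> compatible_morphisms C F m \<eta>"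
proof -
  have mod: "(B, \<rho>) \<in> modules C F m" and comp: "\<rho> \<cdot> m B \<cdot> \<eta> (ob F B) = \<rho>"
    using assms by (auto simp: compatible_module_def theta_def)
  have B: "B \<in> Ob C" and \<rho>: "\<rho> \<in> hom C (ob F B) B" and act: "\<rho> \<cdot> ar F \<rho> = \<rho> \<cdot> m B"
    using mod by (auto simp: modules_def)
  note \<eta>FB = \<eta>_hom[OF ob_Ob[OF B]]
  \<comment> \<open>This is the target-side condition. The source-side one is the compatibility
    hypothesis verbatim, since the source acts by \<open>m B\<close>.\<close>
  have "\<rho> \<cdot> \<eta> B \<cdot> \<rho> = \<rho> \<cdot> ar F \<rho> \<cdot> \<eta> (ob F B)"
    by (simp add: \<eta>_nat[OF \<rho>])
  also have "\<dots> = (\<rho> \<cdot> m B) \<cdot> \<eta> (ob F B)"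
    using Comp_assoc[OF \<eta>FB ar_hom[OF \<rho>] \<rho>] act by simp
  also have "\<dots> = \<rho>"
    using Comp_assoc[OF \<eta>FB m_hom[OF B] \<rho>] comp by simp
  finally show ?thesis
    using action_module_morphism[OF mod] comp by (simp add: compatible_morphisms_def)
qed

lemma coequalising_factors:
  assumes mod: "(B, \<rho>) \<in> modules C F m"
    and h: "((ob F B, m B), h, (Q, \<kappa>)) \<in> compatible_morphisms C F m \<eta>"
    and coeq: "h \<cdot> m B = h \<cdot> ar F \<rho>"
  shows "((B, \<rho>), h \<cdot> \<eta> B, (Q, \<kappa>)) \<in> compatible_morphisms C F m \<eta>"
    and "(h \<cdot> \<eta> B) \<cdot> \<rho> = h"
proof -
  have B: "B \<in> Ob C" and \<rho>: "\<rho> \<in> hom C (ob F B) B"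
    using mod by (auto simp: modules_def)
  have Q: "(Q, \<kappa>) \<in> modules C F m" "Q \<in> Ob C" and \<kappa>: "\<kappa> \<in> hom C (ob F Q) Q"
    and hh: "h \<in> hom C (ob F B) Q" and hmor: "h \<cdot> m B = \<kappa> \<cdot> ar F h"
    and hr: "h \<cdot> m B \<cdot> \<eta> (ob F B) = h" and hl: "\<kappa> \<cdot> \<eta> Q \<cdot> h = h"
    using h by (auto simp: compatible_morphisms_def module_morphisms_def modules_def)
  note \<eta>B = \<eta>_hom[OF B] and \<eta>FB = \<eta>_hom[OF ob_Ob[OF B]]
  have "(h \<cdot> \<eta> B) \<cdot> \<rho> = h \<cdot> ar F \<rho> \<cdot> \<eta> (ob F B)"
    using Comp_assoc[OF \<rho> \<eta>B hh] \<eta>_nat[OF \<rho>] by simp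
  also have "\<dots> = (h \<cdot> m B) \<cdot> \<eta> (ob F B)"
    using Comp_assoc[OF \<eta>FB ar_hom[OF \<rho>] hh] coeq by simp
  also have "\<dots> = h"
    using Comp_assoc[OF \<eta>FB m_hom[OF B] hh] hr by simp
  finally show fact: "(h \<cdot> \<eta> B) \<cdot> \<rho> = h" .
  \<comment> \<open>For \<open>h \<cdot> \<eta> B\<close> to be a module morphism, this composite
    must equal \<open>(h \<cdot> \<eta> B) \<cdot> \<rho>\<close>, already known to be
    \<open>h\<close>.\<close>
  have "\<kappa> \<cdot> ar F (h \<cdot> \<eta> B) = (\<kappa> \<cdot> ar F h) \<cdot> ar F (\<eta> B)"
    using Comp_assoc[OF ar_hom[OF \<eta>B] ar_hom[OF hh] \<kappa>] ar_Comp[OF \<eta>B hh] by simp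
  also have "\<dots> = h \<cdot> m B \<cdot> ar F (\<eta> B)"
    using Comp_assoc[OF ar_hom[OF \<eta>B] m_hom[OF B] hh] hmor by simp
  \<comment> \<open>Exchanging \<open>ar F (\<eta> B)\<close> for \<open>\<eta> (ob F B)\<close>
    after \<open>m B\<close> gives the source-side compatibility of \<open>h\<close>.\<close>
  also have "\<dots> = h"
    using m_\<eta>_comm[OF B] hr by simp
  finally have mor: "((B, \<rho>), h \<cdot> \<eta> B, (Q, \<kappa>)) \<in> module_morphisms C F m"
    using mod Q Comp_hom[OF \<eta>B hh] fact by (simp add: module_morphisms_def)
  have "(h \<cdot> \<eta> B) \<cdot> \<rho> \<cdot> \<eta> B = h \<cdot> \<eta> B"
    using Comp_assoc[OF \<eta>B \<rho> Comp_hom[OF \<eta>B hh]] fact by simp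
  moreover have "\<kappa> \<cdot> \<eta> Q \<cdot> h \<cdot> \<eta> B = h \<cdot> \<eta> B"
    using Comp_assoc[OF \<eta>B hh \<eta>_hom[OF Q(2)]]
      Comp_assoc[OF \<eta>B Comp_hom[OF hh \<eta>_hom[OF Q(2)]] \<kappa>] hl by simp
  ultimately show "((B, \<rho>), h \<cdot> \<eta> B, (Q, \<kappa>)) \<in> compatible_morphisms C F m \<eta>"
    using mor by (simp add: compatible_morphisms_def)
qed

text \<open>Source-side compatibility, reassociated. It makes \<rho> right-cancellable against
  compatible morphisms, which yields uniqueness of the factorisation.\<close>

lemma compatible_morphism_determined:
  assumes "((B, \<rho>), q, N) \<in> compatible_morphisms C F m \<eta>"
  shows "q = (q \<cdot> \<rho>) \<cdot> \<eta> B"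
proof -
  obtain Q \<kappa> where N: "N = (Q, \<kappa>)" by (cases N)
  have "B \<in> Ob C" and \<rho>: "\<rho> \<in> hom C (ob F B) B" and q: "q \<in> hom C B Q" "q \<cdot> \<rho> \<cdot> \<eta> B = q"
    using assms N by (auto simp: compatible_morphisms_def module_morphisms_def modules_def)
  then show ?thesis
    using Comp_assoc[OF \<eta>_hom \<rho> q(1)] by simp
qed

lemma compatible_module_firm:
  assumes comp: "compatible_module C F m \<eta> (B, \<rho>)"
  shows "K_firm C F m (compatible_morphisms C F m \<eta>) (B, \<rho>)"
proof -
  let ?M = "module_category C F m" and ?K = "compatible_morphisms C F m \<eta>"
  let ?FB = "(ob F B, m B)" and ?FFB = "(ob F (ob F B), m (ob F B))"
  have mod: "(B, \<rho>) \<in> modules C F m"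
    using comp by (simp add: compatible_module_def)
  then have B: "B \<in> Ob C" and \<rho>: "\<rho> \<in> hom C (ob F B) B" and act: "\<rho> \<cdot> ar F \<rho> = \<rho> \<cdot> m B"
    by (auto simp: modules_def)
  \<comment> \<open>The fork equation is the module law for \<rho>.\<close>
  have "fork ?M (?FFB, m B, ?FB) (?FFB, ar F \<rho>, ?FB) (?FB, \<rho>, (B, \<rho>))"
    using multiplication_module_morphism[OF B] functor_module_morphism[OF \<rho>]
      action_module_morphism[OF mod] act
    by (simp add: fork_def hom_simps module_category_def)
  moreover have "\<exists>!q. q \<in> ?K \<and> q \<in> hom ?M (B, \<rho>) (Cod ?M h) \<and> h = q \<cdot>\<^bsub>?M\<^esub> (?FB, \<rho>, (B, \<rho>))"
    if hK: "h \<in> ?K" and dom: "Dom ?M h = ?FB"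
      and coeq: "h \<cdot>\<^bsub>?M\<^esub> (?FFB, m B, ?FB) = h \<cdot>\<^bsub>?M\<^esub> (?FFB, ar F \<rho>, ?FB)" for h
  proof -
    \<comment> \<open>Only the source of \<open>h\<close> is prescribed; its target is an arbitrary
      module, and the coequalising condition becomes an equation in the base category.\<close>
    obtain k Q \<kappa> where h: "h = (?FB, k, (Q, \<kappa>))"
      using dom by (cases h) (auto simp: module_category_def)
    have cod: "Cod ?M h = (Q, \<kappa>)" and k: "k \<cdot> m B = k \<cdot> ar F \<rho>"
      using h coeq by (auto simp: module_category_def)
    note fact = coequalising_factors[OF mod hK[unfolded h] k]
    show ?thesis
      unfolding cod
    proof (rule ex1I[of _ "((B, \<rho>), k \<cdot> \<eta> B, (Q, \<kappa>))"])
      show "((B, \<rho>), k \<cdot> \<eta> B, (Q, \<kappa>)) \<in> ?K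
          \<and> ((B, \<rho>), k \<cdot> \<eta> B, (Q, \<kappa>)) \<in> hom ?M (B, \<rho>) (Q, \<kappa>)
          \<and> h = ((B, \<rho>), k \<cdot> \<eta> B, (Q, \<kappa>)) \<cdot>\<^bsub>?M\<^esub> (?FB, \<rho>, (B, \<rho>))"
        using fact h by (auto simp: module_hom module_Comp compatible_morphisms_def)
    next
      fix q
      assume q: "q \<in> ?K \<and> q \<in> hom ?M (B, \<rho>) (Q, \<kappa>) \<and> h = q \<cdot>\<^bsub>?M\<^esub> (?FB, \<rho>, (B, \<rho>))"
      then obtain u where u: "q = ((B, \<rho>), u, (Q, \<kappa>))"
        by (auto simp: module_hom)
      with q h have "k = u \<cdot> \<rho>" and "((B, \<rho>), u, (Q, \<kappa>)) \<in> ?K"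
        by (auto simp: module_Comp)
      with u show "q = ((B, \<rho>), k \<cdot> \<eta> B, (Q, \<kappa>))"
        using compatible_morphism_determined by simp
    qed
  qed
  ultimately show ?thesis
    using compatible_morphisms_comp_closed action_compatible_morphism[OF comp]
    by (simp add: K_firm_def Let_def K_coequaliser_def)
      (simp add: module_category_def)
qed

end

theorem proposition2p10:
  fixes \<B> :: "('o, 'm) category"
    and F :: "('o, 'm) endofunctor_data"
    and m \<eta> :: "'o \<Rightarrow> 'm"
    and B :: 'o and \<rho> :: 'm
  assumes "weak_monad \<B> F m \<eta>"
    and "compatible_module \<B> F m \<eta> (B, \<rho>)"
  shows "K_firm \<B> F m (compatible_morphisms \<B> F m \<eta>) (B, \<rho>)"
  using weak_monad.compatible_module_firm[OF assms] .

end
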